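(* If $f_1,f_2$ depend only on $x^3$, then the following assertions are equivalent: (1) $(I,\tilde g)$ is a flat Riemannian manifold; (2) $f_1$ and $f_2$ are constant, or, for some $i,j\in\{1,2\}$ with $i\neq j$, $f_i=k_i\in\mathbb R\setminus\{0\}$ is constant and $f_j(x^3)=\frac{c_1}{x^3-c_2}$, where $c_1\in\mathbb R\setminus\{0\}$ and $c_2\in\mathbb R\setminus I_3$.
   Context: Let $I=I_1\times I_2\times I_3\subseteq\mathbb R^3$ with $I_1,I_2,I_3\subseteq\mathbb R$ open intervals and standard coordinates $x^1,x^2,x^3$. Let $f_1,f_2$ be smooth nowhere zero functions on $I$ and endow $I$ with the Riemannian metric $\tilde g=\frac{1}{f_1^2}dx^1\otimes dx^1+\frac{1}{f_2^2}dx^2\otimes dx^2+dx^3\otimes dx^3$. Flat means that the Riemann curvature tensor of $\tilde g$ vanishes identically. *)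

theory Defs
  imports "HOL-Analysis.Analysis"
begin

definition partial :: "'n::finite \<Rightarrow> (real^'n \<Rightarrow> real) \<Rightarrow> real^'n \<Rightarrow> real" where
  "partial i f x = deriv (\<lambda>t. f (x + t *\<^sub>R axis i 1)) 0"

text \<open>Both notions below are meant for open sets only: differentiability and partial
  derivatives are taken in the ambient space.\<close>

fun Ck_on :: "nat \<Rightarrow> (real^'n) set \<Rightarrow> (real^'n::finite \<Rightarrow> real) \<Rightarrow> bool" where
  "Ck_on 0 S f \<longleftrightarrow> continuous_on S f"
| "Ck_on (Suc k) S f \<longleftrightarrow>
     (\<forall>x\<in>S. f differentiable (at x)) \<and> (\<forall>i. Ck_on k S (partial i f))"

definition smooth_on :: "(real^'n) set \<Rightarrow> (real^'n::finite \<Rightarrow> real) \<Rightarrow> bool" where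
  "smooth_on S f \<longleftrightarrow> (\<forall>k. Ck_on k S f)"

text \<open>A metric on an open set assigns to each point a bilinear form on \<open>real^'n\<close>, the tangent
  space at that point with its coordinate basis \<open>axis i 1\<close>.\<close>

type_synonym 'n metric_field = "real^'n \<Rightarrow> real^'n \<Rightarrow> real^'n \<Rightarrow> real"

definition metric_matrix :: "'n::finite metric_field \<Rightarrow> real^'n \<Rightarrow> real^'n^'n" where
  "metric_matrix g x = (\<chi> i j. g x (axis i 1) (axis j 1))"

definition riemannian_metric_on :: "(real^'n) set \<Rightarrow> 'n::finite metric_field \<Rightarrow> bool" where
  "riemannian_metric_on S g \<longleftrightarrow>
     (\<forall>x\<in>S. bilinear (g x) \<and> (\<forall>u v. g x u v = g x v u) \<and> (\<forall>v. v \<noteq> 0 \<longrightarrow> g x v v > 0)) \<and>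
     (\<forall>i j. smooth_on S (\<lambda>x. metric_matrix g x $ i $ j))"

text \<open>\<open>christoffel g k i j\<close> is \<open>\<Gamma>\<close> with upper index \<open>k\<close> and lower indices \<open>i\<close>, \<open>j\<close>, for the
  Levi-Civita connection of \<open>g\<close>.\<close>

definition christoffel ::
  "'n::finite metric_field \<Rightarrow> 'n \<Rightarrow> 'n \<Rightarrow> 'n \<Rightarrow> real^'n \<Rightarrow> real" where
  "christoffel g k i j x =
     (1/2) * (\<Sum>l\<in>UNIV. matrix_inv (metric_matrix g x) $ k $ l *
        (partial i (\<lambda>y. metric_matrix g y $ j $ l) x
         + partial j (\<lambda>y. metric_matrix g y $ i $ l) x
         - partial l (\<lambda>y. metric_matrix g y $ i $ j) x))"

text \<open>\<open>riemann g l k i j\<close> is the \<open>l\<close>-th component of \<open>R(\<partial>\<^sub>i, \<partial>\<^sub>j) \<partial>\<^sub>k\<close>, where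
  \<open>R(X, Y) Z = \<nabla>\<^sub>X \<nabla>\<^sub>Y Z - \<nabla>\<^sub>Y \<nabla>\<^sub>X Z - \<nabla>\<^bsub>[X, Y]\<^esub> Z\<close>.\<close>

definition riemann ::
  "'n::finite metric_field \<Rightarrow> 'n \<Rightarrow> 'n \<Rightarrow> 'n \<Rightarrow> 'n \<Rightarrow> real^'n \<Rightarrow> real" where
  "riemann g l k i j x =
     partial i (christoffel g l j k) x - partial j (christoffel g l i k) x
     + (\<Sum>m\<in>UNIV. christoffel g l i m x * christoffel g m j k x
                  - christoffel g l j m x * christoffel g m i k x)"

definition flat_riemannian_manifold :: "(real^'n) set \<Rightarrow> 'n::finite metric_field \<Rightarrow> bool" where
  "flat_riemannian_manifold S g \<longleftrightarrow>
     open S \<and> riemannian_metric_on S g \<and> (\<forall>x\<in>S. \<forall>l k i j. riemann g l k i j x = 0)"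

definition coord_box :: "real set \<Rightarrow> real set \<Rightarrow> real set \<Rightarrow> (real^3) set" where
  "coord_box I1 I2 I3 = {x. x $ 1 \<in> I1 \<and> x $ 2 \<in> I2 \<and> x $ 3 \<in> I3}"

definition g_tilde :: "(real^3 \<Rightarrow> real) \<Rightarrow> (real^3 \<Rightarrow> real) \<Rightarrow> 3 metric_field" where
  "g_tilde f1 f2 x u v =
     1 / (f1 x)\<^sup>2 * (u $ 1 * v $ 1) + 1 / (f2 x)\<^sup>2 * (u $ 2 * v $ 2) + u $ 3 * v $ 3"

definition depends_only_on_x3 :: "(real^3) set \<Rightarrow> (real^3 \<Rightarrow> real) \<Rightarrow> bool" where
  "depends_only_on_x3 S f \<longleftrightarrow> (\<forall>x\<in>S. \<forall>y\<in>S. x $ 3 = y $ 3 \<longrightarrow> f x = f y)"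

end

(* Write u = 1/f1 and v = 1/f2, functions of x3 alone, so that the metric is
   u^2 dx1^2 + v^2 dx2^2 + dx3^2. Its sectional curvatures in the planes (1,3), (2,3), (1,2) are
   - u''/u, - v''/v and - u'v'/(uv), so flatness means that u and v are affine in x3 and at most one
   of them is not constant; in that case its reciprocal is c1/(x3 - c2). The pole c2 lies outside I3
   because u and v do not vanish there. *)

theory Submission
  imports Defs
begin

section \<open>Partial derivatives and the classes C^k on open sets\<close>

lemma partial_eqI:
  assumes "((\<lambda>t. f (x + t *\<^sub>R axis i 1)) has_real_derivative d) (at 0)"
  shows "partial i f x = d"
  using assms unfolding partial_def by (rule DERIV_imp_deriv)

text \<open>The value of \<open>deriv\<close> is meaningful only where a derivative exists.
  Differentiability at \<open>x\<close> passes to the coordinate line through \<open>x\<close>, so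
  \<open>partial\<close> is there a genuine derivative and the usual rules apply to it.\<close>

lemma has_partial:
  fixes f :: "real^'n::finite \<Rightarrow> real"
  assumes "f differentiable (at x)"
  shows "((\<lambda>t. f (x + t *\<^sub>R axis i 1)) has_real_derivative partial i f x) (at 0)"
proof -
  have "(\<lambda>t::real. f (x + t *\<^sub>R axis i 1)) differentiable (at 0)"
    by (rule differentiable_compose[of f]) (use assms in \<open>auto intro!: derivative_intros\<close>)
  then show ?thesis
    unfolding partial_def
    by (simp add: DERIV_deriv_iff_real_differentiable)
qed

lemma eventually_line_in_open:
  fixes x :: "real^'n::finite"
  assumes "open S" "x \<in> S"
  shows "\<forall>\<^sub>F t::real in nhds 0. x + t *\<^sub>R axis i 1 \<in> S"
proof -
  have "((\<lambda>t::real. x + t *\<^sub>R axis i 1) \<longlongrightarrow> x + 0 *\<^sub>R axis i 1) (nhds 0)"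
    by (intro tendsto_intros filterlim_ident)
  then show ?thesis
    using assms by (auto dest: topological_tendstoD)
qed

text \<open>A short segment of the coordinate line through \<open>x\<close> stays in the open set,
  so both functions agree near 0 along it and have the same germ.\<close>

lemma partial_cong:
  assumes "open S" "x \<in> S" "\<And>y. y \<in> S \<Longrightarrow> f y = g y"
  shows "partial i f x = partial i g x"
  unfolding partial_def using eventually_line_in_open[OF assms(1,2), of i]
  by (intro deriv_cong_ev) (auto elim: eventually_mono simp: assms(3))

lemma differentiable_transform_open:
  assumes "open S" "x \<in> S" "f differentiable (at x)" "\<And>y. y \<in> S \<Longrightarrow> f y = g y"
  shows "g differentiable (at x)"
proof -
  from assms(3) obtain D where "(f has_derivative D) (at x)"
    by (auto simp: differentiable_def)
  then have "(g has_derivative D) (at x)"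
    by (rule has_derivative_transform_within_open) (use assms in auto)
  then show ?thesis by (auto simp: differentiable_def)
qed

text \<open>Serves to replace a partial derivative by a formula that is valid only on
  \<open>S\<close>. The functions must vary in the induction, since the step passes to their partial
  derivatives.\<close>

lemma Ck_on_cong:
  fixes f g :: "real^'n::finite \<Rightarrow> real"
  assumes "open S" "\<And>y. y \<in> S \<Longrightarrow> f y = g y"
  shows "Ck_on k S f \<longleftrightarrow> Ck_on k S g"
  using assms(2)
proof (induction k arbitrary: f g)
  case 0
  then show ?case by (simp cong: continuous_on_cong)
next
  case (Suc k)
  have "Ck_on k S (partial i f) \<longleftrightarrow> Ck_on k S (partial i g)" for i
    by (rule Suc.IH) (use assms(1) Suc.prems in \<open>auto intro: partial_cong\<close>)
  moreover have "f differentiable (at x) \<longleftrightarrow> g differentiable (at x)" if "x \<in> S" for x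
    using differentiable_transform_open[OF assms(1) that, of f g]
      differentiable_transform_open[OF assms(1) that, of g f] Suc.prems by auto
  ultimately show ?case by simp
qed

text \<open>Needed for product and reciprocal: their derivatives still contain undifferentiated
  factors, which have to lie in the lower class as well.\<close>

lemma Ck_on_Suc_imp: "Ck_on (Suc k) S f \<Longrightarrow> Ck_on k S f"
proof (induction k arbitrary: f)
  case 0
  then have "continuous (at x) f" if "x \<in> S" for x
    using that differentiable_imp_continuous_within by auto
  then show ?case
    by (simp add: continuous_at_imp_continuous_on)
next
  case (Suc k)
  then have "Ck_on k S (partial i f)" for i
    unfolding Ck_on.simps(2)[of "Suc k" S f] by blast
  with Suc.prems show ?case by simp
qed

lemma partial_const: "partial i (\<lambda>x. c) = (\<lambda>x. 0)"
  by (simp add: partial_def fun_eq_iff)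

lemma Ck_on_const: "Ck_on k S (\<lambda>x. c)"
  by (induction k arbitrary: c) (auto simp: partial_const)

lemma partial_mult:
  assumes "f differentiable (at x)" "g differentiable (at x)"
  shows "partial i (\<lambda>y. f y * g y) x = partial i f x * g x + partial i g x * f x"
  using DERIV_mult[OF has_partial[OF assms(1)] has_partial[OF assms(2)], of i i]
  by (intro partial_eqI) simp

lemma partial_add:
  assumes "f differentiable (at x)" "g differentiable (at x)"
  shows "partial i (\<lambda>y. f y + g y) x = partial i f x + partial i g x"
  using DERIV_add[OF has_partial[OF assms(1)] has_partial[OF assms(2)], of i i]
  by (intro partial_eqI) simp

lemma Ck_on_add:
  assumes "open S" "Ck_on k S f" "Ck_on k S g"
  shows "Ck_on k S (\<lambda>x. f x + g x)"
  using assms(2,3)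
proof (induction k arbitrary: f g)
  case (Suc k)
  have "Ck_on k S (partial i (\<lambda>x. f x + g x))" for i
    using Ck_on_cong[OF assms(1), of "partial i (\<lambda>x. f x + g x)"
        "\<lambda>x. partial i f x + partial i g x"] Suc
    by (simp add: partial_add)
  then show ?case using Suc.prems by simp
qed (auto intro: continuous_intros)

lemma Ck_on_mult:
  assumes "open S" "Ck_on k S f" "Ck_on k S g"
  shows "Ck_on k S (\<lambda>x. f x * g x)"
  using assms(2,3)
proof (induction k arbitrary: f g)
  case (Suc k)
  have "Ck_on k S f" "Ck_on k S g"
    using Suc.prems Ck_on_Suc_imp by blast+
  with Suc have "Ck_on k S (\<lambda>x. partial i f x * g x + partial i g x * f x)" for i
    by (auto intro!: Ck_on_add[OF assms(1)])
  then have "Ck_on k S (partial i (\<lambda>x. f x * g x))" for i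
    using Ck_on_cong[OF assms(1), of "partial i (\<lambda>x. f x * g x)"
        "\<lambda>x. partial i f x * g x + partial i g x * f x"] Suc.prems
    by (simp add: partial_mult)
  then show ?case using Suc.prems by simp
qed (auto intro: continuous_intros)

text \<open>The quotient rule, written as a pure product with constant factor -1, so that closure
  under products and constants handles it.\<close>

lemma partial_inverse:
  assumes "f differentiable (at x)" "f x \<noteq> 0"
  shows "partial i (\<lambda>y. inverse (f y)) x = (- 1) * (partial i f x * (inverse (f x) * inverse (f x)))"
  using DERIV_inverse_fun[OF has_partial[OF assms(1)], of i] assms(2)
  by (intro partial_eqI) (simp add: mult_ac power2_eq_square)

text \<open>The derivative of the reciprocal is a product of \<open>partial i f\<close> and
  reciprocals of \<open>f\<close>, and the induction hypothesis covers the latter at level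
  \<open>k\<close>.\<close>

lemma Ck_on_inverse:
  assumes "open S" "Ck_on k S f" "\<And>x. x \<in> S \<Longrightarrow> f x \<noteq> 0"
  shows "Ck_on k S (\<lambda>x. inverse (f x))"
  using assms(2)
proof (induction k)
  case (Suc k)
  have "Ck_on k S (\<lambda>x. inverse (f x))"
    using Suc Ck_on_Suc_imp by blast
  with Suc.prems have "Ck_on k S (\<lambda>x. (- 1) * (partial i f x * (inverse (f x) * inverse (f x))))" for i
    by (intro Ck_on_mult[OF assms(1)] Ck_on_const) auto
  then have "Ck_on k S (partial i (\<lambda>x. inverse (f x)))" for i
    using Ck_on_cong[OF assms(1), of "partial i (\<lambda>x. inverse (f x))"
        "\<lambda>x. (- 1) * (partial i f x * (inverse (f x) * inverse (f x)))"] Suc.prems assms(3)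
    by (simp add: partial_inverse)
  then show ?case using Suc.prems assms(3) by simp
qed (auto intro: continuous_intros simp: assms(3))

section \<open>Functions of the third coordinate alone\<close>

lemma open_coord_box:
  assumes "open I1" "open I2" "open I3"
  shows "open (coord_box I1 I2 I3)"
proof -
  have "coord_box I1 I2 I3 = (\<lambda>x. x $ 1) -` I1 \<inter> (\<lambda>x. x $ 2) -` I2 \<inter> (\<lambda>x. x $ 3) -` I3"
    by (auto simp: coord_box_def)
  then show ?thesis
    using assms by (simp add: open_Int open_vimage_vec_nth)
qed

text \<open>Moving along axis 1 or 2 leaves \<open>x $ 3\<close> fixed, and moving along axis 3
  translates the argument of \<open>H\<close>.\<close>

lemma partial_x3:
  fixes h :: "real^3 \<Rightarrow> real"
  assumes "open S" "x \<in> S" "\<And>y. y \<in> S \<Longrightarrow> h y = H (y $ 3)"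
    and "(H has_real_derivative D) (at (x $ 3))"
  shows "partial i h x = (if i = 3 then D else 0)"
proof -
  have "partial i h x = partial i (\<lambda>y. H (y $ 3)) x"
    by (rule partial_cong[OF assms(1,2)]) (rule assms(3))
  also have "\<dots> = (if i = 3 then D else 0)"
  proof (cases "i = 3")
    case True
    have "((\<lambda>t. H (x $ 3 + t)) has_real_derivative D) (at 0)"
      using assms(4) DERIV_shift[of H D 0 "x $ 3"] by (simp add: add.commute)
    with True have "partial i (\<lambda>y. H (y $ 3)) x = D"
      by (intro partial_eqI) (simp add: axis_def)
    with True show ?thesis by simp
  next
    case False
    then have "partial i (\<lambda>y. H (y $ 3)) x = 0"
      by (intro partial_eqI) (simp add: axis_def)
    with False show ?thesis by simp
  qed
  finally show ?thesis .
qed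

text \<open>Regularity passes from \<open>h\<close> down to its one-variable profile: near
  \<open>x\<close> the line in direction 3 stays in \<open>S\<close>, and along it \<open>h\<close>
  is a translate of \<open>H\<close>.\<close>

lemma DERIV_profile:
  fixes h :: "real^3 \<Rightarrow> real"
  assumes "open S" "x \<in> S" "\<And>y. y \<in> S \<Longrightarrow> h y = H (y $ 3)"
    and "h differentiable (at x)"
  shows "(H has_real_derivative partial 3 h x) (at (x $ 3))"
proof -
  have "((\<lambda>t. h (x + t *\<^sub>R axis 3 1)) has_real_derivative partial 3 h x) (at 0)"
    by (rule has_partial[OF assms(4)])
  moreover have "\<forall>\<^sub>F t in nhds 0. h (x + t *\<^sub>R axis 3 1) = H (x $ 3 + t)"
    using eventually_line_in_open[OF assms(1,2), of 3]
    by (rule eventually_mono) (simp add: assms(3) axis_def)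
  ultimately have "((\<lambda>t. H (x $ 3 + t)) has_real_derivative partial 3 h x) (at 0)"
    by (simp add: DERIV_cong_ev[OF refl _ refl])
  then show ?thesis
    using DERIV_shift[of H "partial 3 h x" 0 "x $ 3"] by (simp add: add.commute)
qed

lemma smooth_on_inverse:
  assumes "open S" "smooth_on S f" "\<And>x. x \<in> S \<Longrightarrow> f x \<noteq> 0"
  shows "smooth_on S (\<lambda>x. inverse (f x))"
  unfolding smooth_on_def
  using assms(2,3) by (auto simp: smooth_on_def intro: Ck_on_inverse[OF assms(1)])

lemma smooth_profile:
  fixes h :: "real^3 \<Rightarrow> real"
  assumes "open S" "smooth_on S h" "\<And>y. y \<in> S \<Longrightarrow> h y = H (y $ 3)"
    and "t \<in> (\<lambda>x. x $ 3) ` S"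
  shows "(H has_real_derivative deriv H t) (at t)"
    and "(deriv H has_real_derivative deriv (deriv H) t) (at t)"
proof -
  have C2: "Ck_on (Suc (Suc 0)) S h"
    using assms(2) unfolding smooth_on_def by blast
  have D: "(H has_real_derivative partial 3 h x) (at (x $ 3))" if "x \<in> S" for x
    by (rule DERIV_profile[OF assms(1) that]) (use assms(3) C2 that in auto)
  then have partial_h: "partial 3 h x = deriv H (x $ 3)" if "x \<in> S" for x
    using that by (metis DERIV_imp_deriv)
  \<comment> \<open>The function \<open>partial 3 h\<close> again depends on the third coordinate
    alone, with profile \<open>deriv H\<close>, so the same argument applies a second time.\<close>
  have D2: "(deriv H has_real_derivative partial 3 (partial 3 h) x) (at (x $ 3))" if "x \<in> S" for x
    by (rule DERIV_profile[where H = "deriv H", OF assms(1) that]) (use C2 that partial_h in auto)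
  obtain x where x: "x \<in> S" "t = x $ 3"
    using assms(4) by blast
  show "(H has_real_derivative deriv H t) (at t)"
    unfolding x(2) DERIV_imp_deriv[OF D[OF x(1)]] by (rule D[OF x(1)])
  show "(deriv H has_real_derivative deriv (deriv H) t) (at t)"
    unfolding x(2) DERIV_imp_deriv[OF D2[OF x(1)]] by (rule D2[OF x(1)])
qed

section \<open>Affine functions of one variable\<close>

text \<open>A zero derivative on a convex set forces a constant. This is used twice: for
  \<open>du\<close>, then for \<open>u\<close> minus its linear part.\<close>

lemma affine_of_second_derivative_zero:
  fixes u :: "real \<Rightarrow> real"
  assumes "convex J"
    and "\<And>t. t \<in> J \<Longrightarrow> (u has_real_derivative du t) (at t)"
    and "\<And>t. t \<in> J \<Longrightarrow> (du has_real_derivative 0) (at t)"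
  obtains \<alpha> \<beta> where "\<forall>t\<in>J. du t = \<alpha> \<and> u t = \<alpha> * t + \<beta>"
proof -
  obtain \<alpha> where \<alpha>: "\<And>t. t \<in> J \<Longrightarrow> du t = \<alpha>"
    using has_field_derivative_zero_constant[OF assms(1) has_field_derivative_at_within[OF assms(3)]]
    by blast
  have "((\<lambda>t. u t - \<alpha> * t) has_real_derivative 0) (at t within J)" if "t \<in> J" for t
  proof -
    have "((\<lambda>t. u t - \<alpha> * t) has_real_derivative du t - \<alpha>) (at t)"
      by (rule DERIV_diff[OF assms(2)[OF that] DERIV_cmult_Id])
    then show ?thesis
      using \<alpha>[OF that] has_field_derivative_at_within by fastforce
  qed
  then obtain \<beta> where \<beta>: "\<forall>t\<in>J. u t - \<alpha> * t = \<beta>"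
    using has_field_derivative_zero_constant[OF assms(1), of "\<lambda>t. u t - \<alpha> * t"] by blast
  have "u t = \<alpha> * t + \<beta>" if "t \<in> J" for t
    using \<beta> that by (simp add: algebra_simps)
  with \<alpha> show thesis using that by blast
qed

lemma derivatives_of_affine:
  fixes u :: "real \<Rightarrow> real"
  assumes "open J" "\<And>t. t \<in> J \<Longrightarrow> u t = \<alpha> * t + \<beta>"
    and "\<And>t. t \<in> J \<Longrightarrow> (u has_real_derivative du t) (at t)"
    and "\<And>t. t \<in> J \<Longrightarrow> (du has_real_derivative ddu t) (at t)"
    and "t \<in> J"
  shows "du t = \<alpha>" "ddu t = 0"
proof -
  \<comment> \<open>Shown on all of \<open>J\<close>, not only at \<open>t\<close>, because
    \<open>du\<close> has to be constant near \<open>t\<close> before it can be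
    differentiated.\<close>
  have du: "du s = \<alpha>" if "s \<in> J" for s
  proof -
    have "((\<lambda>t. \<alpha> * t + \<beta>) has_real_derivative \<alpha>) (at s)"
      by (auto intro!: derivative_eq_intros)
    then have "(u has_real_derivative \<alpha>) (at s)"
      by (rule has_field_derivative_transform_within_open[OF _ assms(1) that]) (simp add: assms(2))
    with assms(3)[OF that] show ?thesis by (rule DERIV_unique)
  qed
  then show "du t = \<alpha>" using assms(5) .
  have "((\<lambda>t. \<alpha>) has_real_derivative 0) (at t)" by simp
  then have "(du has_real_derivative 0) (at t)"
    by (rule has_field_derivative_transform_within_open[OF _ assms(1,5)]) (simp add: du)
  with assms(4)[OF assms(5)] show "ddu t = 0" by (rule DERIV_unique)
qed

section \<open>Diagonal matrices and the Riemannian metric\<close>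

lemma diag_matrix_mult:
  fixes a b :: "'n::finite \<Rightarrow> real"
  shows "(\<chi> i j. if i = j then a i else 0) ** (\<chi> i j. if i = j then b i else 0) =
    (\<chi> i j. if i = j then a i * b i else 0)"
proof -
  have "(\<Sum>k\<in>UNIV. (if i = k then a i else 0) * (if k = j then b k else 0)) =
      (if i = j then a i * b i else 0)" for i j
  proof -
    have "(\<Sum>k\<in>UNIV. (if i = k then a i else 0) * (if k = j then b k else 0)) =
        (\<Sum>k\<in>UNIV. if i = k then a k * (if k = j then b k else 0) else 0)"
      by (rule sum.cong) auto
    then show ?thesis by simp
  qed
  then show ?thesis
    by (simp only: matrix_matrix_mult_def vec_lambda_beta vec_eq_iff) simp
qed

text \<open>\<open>matrix_inv\<close> is a choice among two-sided inverses. The explicit diagonal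
  inverse shows that the choice is not empty, and associativity then identifies the chosen matrix
  with it.\<close>

lemma matrix_inv_diag:
  fixes d :: "'n::finite \<Rightarrow> real"
  assumes "\<And>i. d i \<noteq> 0"
  shows "matrix_inv (\<chi> i j. if i = j then d i else 0) = (\<chi> i j. if i = j then inverse (d i) else 0)"
    (is "matrix_inv ?A = ?B")
proof -
  have A: "?A ** ?B = mat 1" "?B ** ?A = mat 1"
    unfolding diag_matrix_mult using assms by (simp_all add: mat_def vec_eq_iff)
  then have "matrix_inv ?A ** ?A = mat 1"
    unfolding matrix_inv_def using someI[of "\<lambda>A'. ?A ** A' = mat 1 \<and> A' ** ?A = mat 1" ?B] by blast
  with A(1) show ?thesis
    using matrix_mul_assoc[of "matrix_inv ?A" ?A ?B] by simp
qed

text \<open>The form required by \<open>matrix_inv_diag\<close>, with reciprocals of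
  \<open>f1\<close> and \<open>f2\<close> in place of quotients. It holds at every \<open>x\<close>,
  since 1/0 and \<open>inverse 0\<close> are both 0.\<close>

lemma metric_matrix_g_tilde:
  "metric_matrix (g_tilde f1 f2) x =
    (\<chi> i j. if i = j then (if i = 1 then (inverse (f1 x))\<^sup>2 else if i = 2 then (inverse (f2 x))\<^sup>2 else 1) else 0)"
  by (simp add: metric_matrix_def g_tilde_def vec_eq_iff forall_3 axis_def) (simp add: field_simps)

lemma riemannian_metric_on_g_tilde:
  assumes "open S" "smooth_on S f1" "smooth_on S f2"
    and "\<And>x. x \<in> S \<Longrightarrow> f1 x \<noteq> 0" "\<And>x. x \<in> S \<Longrightarrow> f2 x \<noteq> 0"
  shows "riemannian_metric_on S (g_tilde f1 f2)"
proof -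
  have "bilinear (g_tilde f1 f2 x)" for x
    by (auto simp: bilinear_def g_tilde_def algebra_simps add_divide_distrib intro!: linearI)
  moreover have "g_tilde f1 f2 x u v = g_tilde f1 f2 x v u" for x u v
    by (simp add: g_tilde_def mult_ac)
  moreover have "g_tilde f1 f2 x v v > 0" if "x \<in> S" "v \<noteq> 0" for x v
  proof -
    \<comment> \<open>A sum of three squares, at least one of which is nonzero.\<close>
    have eq: "g_tilde f1 f2 x v v = (v $ 1 / f1 x)\<^sup>2 + (v $ 2 / f2 x)\<^sup>2 + (v $ 3)\<^sup>2"
      by (simp add: g_tilde_def power2_eq_square)
    from that(2) consider "v $ 1 \<noteq> 0" | "v $ 2 \<noteq> 0" | "v $ 3 \<noteq> 0"
      by (auto simp: vec_eq_iff forall_3)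
    then have "v $ 1 / f1 x \<noteq> 0 \<or> v $ 2 / f2 x \<noteq> 0 \<or> v $ 3 \<noteq> 0"
      using assms(4,5)[OF that(1)] by cases auto
    then show ?thesis
      unfolding eq by (smt (verit) zero_less_power2 zero_le_power2)
  qed
  moreover have "smooth_on S (\<lambda>x. metric_matrix (g_tilde f1 f2) x $ i $ j)" for i j
  proof -
    have "Ck_on k S (\<lambda>x. (inverse (f1 x))\<^sup>2)" "Ck_on k S (\<lambda>x. (inverse (f2 x))\<^sup>2)" for k
      unfolding power2_eq_square using assms(2-5)
      by (intro Ck_on_mult[OF assms(1)] Ck_on_inverse[OF assms(1)]; simp add: smooth_on_def)+
    then show ?thesis
      by (cases "i = j"; cases "i = 1"; cases "i = 2")
        (simp_all add: metric_matrix_g_tilde smooth_on_def Ck_on_const)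
  qed
  ultimately show ?thesis
    by (simp add: riemannian_metric_on_def)
qed

section \<open>Curvature in terms of the one-variable profiles\<close>

text \<open>The profiles are those of the reciprocals 1/f1 and 1/f2: the metric coefficients become
  u^2, v^2, 1, and flatness becomes u'' = v'' = u'v' = 0.\<close>

locale x3_profile =
  fixes S :: "(real^3) set" and J :: "real set" and f1 f2 :: "real^3 \<Rightarrow> real"
    and u v du dv ddu ddv :: "real \<Rightarrow> real"
  assumes open_S: "open S" and x3_image: "(\<lambda>x. x $ 3) ` S = J"
    and u: "x \<in> S \<Longrightarrow> inverse (f1 x) = u (x $ 3)" and v: "x \<in> S \<Longrightarrow> inverse (f2 x) = v (x $ 3)"
    and u_nz: "t \<in> J \<Longrightarrow> u t \<noteq> 0" and v_nz: "t \<in> J \<Longrightarrow> v t \<noteq> 0"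
    and du: "t \<in> J \<Longrightarrow> (u has_real_derivative du t) (at t)"
    and dv: "t \<in> J \<Longrightarrow> (v has_real_derivative dv t) (at t)"
    and ddu: "t \<in> J \<Longrightarrow> (du has_real_derivative ddu t) (at t)"
    and ddv: "t \<in> J \<Longrightarrow> (dv has_real_derivative ddv t) (at t)"
begin

text \<open>The Christoffel symbols of u^2 dx1^2 + v^2 dx2^2 + dx3^2, with upper index
  \<open>k\<close>, as functions of x3. Up to symmetry in the lower indices, only four can be
  nonzero.\<close>

definition christoffel_profile :: "3 \<Rightarrow> 3 \<Rightarrow> 3 \<Rightarrow> real \<Rightarrow> real" where
  "christoffel_profile k i j t =
    (if k = 3 then (if i = j then (if i = 1 then - (u t * du t) else if i = 2 then - (v t * dv t) else 0) else 0)
     else if (i = k \<and> j = 3) \<or> (i = 3 \<and> j = k) then (if k = 1 then du t / u t else dv t / v t)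
     else 0)"

definition christoffel_profile_deriv :: "3 \<Rightarrow> 3 \<Rightarrow> 3 \<Rightarrow> real \<Rightarrow> real" where
  "christoffel_profile_deriv k i j t =
    (if k = 3 then (if i = j then
       (if i = 1 then - (du t * du t + ddu t * u t) else if i = 2 then - (dv t * dv t + ddv t * v t) else 0) else 0)
     else if (i = k \<and> j = 3) \<or> (i = 3 \<and> j = k) then
       (if k = 1 then (ddu t * u t - du t * du t) / (u t * u t) else (ddv t * v t - dv t * dv t) / (v t * v t))
     else 0)"

lemma x3_mem: "x \<in> S \<Longrightarrow> x $ 3 \<in> J"
  using x3_image by blast

lemma DERIV_christoffel_profile:
  assumes "t \<in> J"
  shows "(christoffel_profile k i j has_real_derivative christoffel_profile_deriv k i j t) (at t)"
proof -
  have "((\<lambda>t. - (u t * du t)) has_real_derivative - (du t * du t + ddu t * u t)) (at t)"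
    by (rule DERIV_minus[OF DERIV_mult[OF du[OF assms] ddu[OF assms]]])
  moreover have "((\<lambda>t. - (v t * dv t)) has_real_derivative - (dv t * dv t + ddv t * v t)) (at t)"
    by (rule DERIV_minus[OF DERIV_mult[OF dv[OF assms] ddv[OF assms]]])
  moreover have "((\<lambda>t. du t / u t) has_real_derivative (ddu t * u t - du t * du t) / (u t * u t)) (at t)"
    by (rule DERIV_divide[OF ddu[OF assms] du[OF assms] u_nz[OF assms]])
  moreover have "((\<lambda>t. dv t / v t) has_real_derivative (ddv t * v t - dv t * dv t) / (v t * v t)) (at t)"
    by (rule DERIV_divide[OF ddv[OF assms] dv[OF assms] v_nz[OF assms]])
  ultimately have "\<forall>k i j. (christoffel_profile k i j has_real_derivative christoffel_profile_deriv k i j t) (at t)"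
    unfolding christoffel_profile_def[abs_def] christoffel_profile_deriv_def forall_3 by simp
  then show ?thesis by blast
qed

lemma partial_metric:
  assumes "x \<in> S"
  shows "partial i (\<lambda>y. metric_matrix (g_tilde f1 f2) y $ j $ l) x =
    (if i = 3 \<and> j = l then
      (if j = 1 then 2 * u (x $ 3) * du (x $ 3) else if j = 2 then 2 * v (x $ 3) * dv (x $ 3) else 0)
     else 0)" (is "?l = ?r")
proof -
  have "?l = (if i = 3 then (if j = l then
      (if j = 1 then 2 * u (x $ 3) * du (x $ 3) else if j = 2 then 2 * v (x $ 3) * dv (x $ 3) else 0)
     else 0) else 0)"
    by (rule partial_x3[OF open_S assms, where H = "\<lambda>t. if j = l then (if j = 1 then (u t)\<^sup>2 else if j = 2 then (v t)\<^sup>2 else 1) else 0"])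
      (use x3_mem[OF assms] in \<open>auto simp: metric_matrix_g_tilde u v intro!: derivative_eq_intros du dv\<close>)
  then show ?thesis by simp
qed

text \<open>The inverse metric is diagonal, so the sum over \<open>l\<close> keeps only
  \<open>l = k\<close>; the finitely many index triples are then checked one by one.\<close>

lemma christoffel_eq:
  assumes "x \<in> S"
  shows "christoffel (g_tilde f1 f2) k i j x = christoffel_profile k i j (x $ 3)"
proof -
  have nz: "u (x $ 3) \<noteq> 0" "v (x $ 3) \<noteq> 0"
    using u_nz v_nz x3_mem[OF assms] by auto
  have "matrix_inv (metric_matrix (g_tilde f1 f2) x) =
     (\<chi> i j. if i = j then inverse (if i = 1 then (u (x $ 3))\<^sup>2 else if i = 2 then (v (x $ 3))\<^sup>2 else 1) else 0)"
    unfolding metric_matrix_g_tilde u[OF assms] v[OF assms]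
    by (rule matrix_inv_diag) (use nz in auto)
  then have "\<forall>k i j. christoffel (g_tilde f1 f2) k i j x = christoffel_profile k i j (x $ 3)"
    unfolding christoffel_def partial_metric[OF assms] christoffel_profile_def
    using nz by (simp add: forall_3 sum_3 power2_eq_square field_simps)
  then show ?thesis by blast
qed

lemma riemann_eq:
  assumes "x \<in> S"
  shows "riemann (g_tilde f1 f2) l k i j x =
    (if i = 3 then christoffel_profile_deriv l j k (x $ 3) else 0) - (if j = 3 then christoffel_profile_deriv l i k (x $ 3) else 0)
    + (\<Sum>m\<in>UNIV. christoffel_profile l i m (x $ 3) * christoffel_profile m j k (x $ 3) - christoffel_profile l j m (x $ 3) * christoffel_profile m i k (x $ 3))"
proof -
  have "partial i (christoffel (g_tilde f1 f2) l j k) x = (if i = 3 then christoffel_profile_deriv l j k (x $ 3) else 0)" for i j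
    \<comment> \<open>Differentiation needs \<open>christoffel_eq\<close> on all of
      \<open>S\<close>, not only at \<open>x\<close>.\<close>
    by (rule partial_x3[OF open_S assms christoffel_eq DERIV_christoffel_profile[OF x3_mem[OF assms]]])
  then show ?thesis
    by (simp add: riemann_def christoffel_eq[OF assms])
qed

lemma riemann_vanishes_iff:
  assumes "x \<in> S"
  shows "(\<forall>l k i j. riemann (g_tilde f1 f2) l k i j x = 0) \<longleftrightarrow>
    ddu (x $ 3) = 0 \<and> ddv (x $ 3) = 0 \<and> du (x $ 3) * dv (x $ 3) = 0" (is "?L \<longleftrightarrow> ?R")
proof
  have nz: "u (x $ 3) \<noteq> 0" "v (x $ 3) \<noteq> 0"
    using u_nz v_nz x3_mem[OF assms] by auto
  note eq = riemann_eq[OF assms] christoffel_profile_def christoffel_profile_deriv_def sum_3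
  {
    assume L: ?L
    \<comment> \<open>These components are -u''/u, -v''/v and -v u'v'/u, one for each coordinate
      plane.\<close>
    have "riemann (g_tilde f1 f2) 1 3 1 3 x = 0" "riemann (g_tilde f1 f2) 2 3 2 3 x = 0"
      "riemann (g_tilde f1 f2) 1 2 1 2 x = 0"
      using L by blast+
    then show ?R
      using nz by (simp add: eq field_simps)
  next
    assume ?R
    then show ?L
      using nz by (auto simp: forall_3 eq field_simps)
  }
qed

text \<open>Pointwise, u'v' = 0 would allow the vanishing factor to change from point to point. Once
  u and v are affine their derivatives are constant, and the condition becomes one equation between
  slopes.\<close>

lemma riemann_vanishes_iff_affine:
  assumes "open J" "convex J" "J \<noteq> {}"
  shows "(\<forall>x\<in>S. \<forall>l k i j. riemann (g_tilde f1 f2) l k i j x = 0) \<longleftrightarrow>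
    (\<exists>\<alpha> \<beta> \<gamma> \<delta>. \<alpha> * \<gamma> = 0 \<and> (\<forall>t\<in>J. u t = \<alpha> * t + \<beta> \<and> v t = \<gamma> * t + \<delta>))" (is "_ \<longleftrightarrow> ?R")
proof -
  have "(\<forall>x\<in>S. \<forall>l k i j. riemann (g_tilde f1 f2) l k i j x = 0) \<longleftrightarrow>
      (\<forall>t\<in>J. ddu t = 0 \<and> ddv t = 0 \<and> du t * dv t = 0)"
    unfolding x3_image[symmetric] by (simp add: riemann_vanishes_iff)
  also have "\<dots> \<longleftrightarrow> ?R"
  proof
    assume *: "\<forall>t\<in>J. ddu t = 0 \<and> ddv t = 0 \<and> du t * dv t = 0"
    have ddu0: "(du has_real_derivative 0) (at t)" and ddv0: "(dv has_real_derivative 0) (at t)"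
      if "t \<in> J" for t
      using ddu[OF that] ddv[OF that] * that by simp_all
    obtain \<alpha> \<beta> where u': "\<forall>t\<in>J. du t = \<alpha> \<and> u t = \<alpha> * t + \<beta>"
      by (rule affine_of_second_derivative_zero[OF assms(2) du ddu0])
    obtain \<gamma> \<delta> where v': "\<forall>t\<in>J. dv t = \<gamma> \<and> v t = \<gamma> * t + \<delta>"
      by (rule affine_of_second_derivative_zero[OF assms(2) dv ddv0])
    \<comment> \<open>A single point suffices, as \<open>du\<close> and \<open>dv\<close> are
      constant on \<open>J\<close>.\<close>
    obtain t where "t \<in> J" using assms(3) by blast
    then have "\<alpha> * \<gamma> = 0" using * u' v' by fastforce
    then show ?R using u' v' by blast
  next
    assume ?R
    then obtain \<alpha> \<beta> \<gamma> \<delta> where "\<alpha> * \<gamma> = 0"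
      and *: "\<And>t. t \<in> J \<Longrightarrow> u t = \<alpha> * t + \<beta>" "\<And>t. t \<in> J \<Longrightarrow> v t = \<gamma> * t + \<delta>"
      by blast
    moreover have "du t = \<alpha>" "ddu t = 0" "dv t = \<gamma>" "ddv t = 0" if "t \<in> J" for t
      by (rule derivatives_of_affine[OF assms(1) *(1) du ddu that]
          derivatives_of_affine[OF assms(1) *(2) dv ddv that]; assumption)+
    ultimately show "\<forall>t\<in>J. ddu t = 0 \<and> ddv t = 0 \<and> du t * dv t = 0"
      by simp
  qed
  finally show ?thesis .
qed

end

section \<open>From affine reciprocals to the classification of flat metrics\<close>

theorem proposition2p2:
  fixes I1 I2 I3 :: "real set" and f1 f2 :: "real^3 \<Rightarrow> real" and I :: "(real^3) set"
  assumes "open I1" "is_interval I1" "I1 \<noteq> {}"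
    and "open I2" "is_interval I2" "I2 \<noteq> {}"
    and "open I3" "is_interval I3" "I3 \<noteq> {}"
    and "I = coord_box I1 I2 I3"
    and "smooth_on I f1" "smooth_on I f2"
    and "\<forall>x\<in>I. f1 x \<noteq> 0" "\<forall>x\<in>I. f2 x \<noteq> 0"
    and "depends_only_on_x3 I f1" "depends_only_on_x3 I f2"
  shows "flat_riemannian_manifold I (g_tilde f1 f2) \<longleftrightarrow>
    ((\<exists>k1 k2. \<forall>x\<in>I. f1 x = k1 \<and> f2 x = k2) \<or>
     (\<exists>(fi, fj) \<in> {(f1, f2), (f2, f1)}. \<exists>k c1 c2.
        k \<noteq> 0 \<and> c1 \<noteq> 0 \<and> c2 \<notin> I3 \<and>
        (\<forall>x\<in>I. fi x = k \<and> fj x = c1 / (x $ 3 - c2))))"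
    (is "_ \<longleftrightarrow> ?R")
proof -
  have open_I: "open I"
    using assms by (simp add: open_coord_box)
  obtain a b where ab: "a \<in> I1" "b \<in> I2"
    using assms(3,6) by blast
  \<comment> \<open>A section of the third coordinate over \<open>I3\<close>. Restricting to this
    line turns \<open>f1\<close> and \<open>f2\<close> into functions of one variable.\<close>
  define e :: "real \<Rightarrow> real^3" where "e t = vector [a, b, t]" for t
  have e: "e t \<in> I" if "t \<in> I3" for t
    using that ab assms(10) by (simp add: e_def coord_box_def)
  have e3: "e t $ 3 = t" for t
    by (simp add: e_def)
  have x3: "x $ 3 \<in> I3" if "x \<in> I" for x
    using that assms(10) by (simp add: coord_box_def)
  define u v where "u t = inverse (f1 (e t))" and "v t = inverse (f2 (e t))" for t
  have u: "inverse (f1 x) = u (x $ 3)" and v: "inverse (f2 x) = v (x $ 3)" if "x \<in> I" for x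
    using assms(15,16) that e[OF x3[OF that]] e3[of "x $ 3", symmetric]
    unfolding depends_only_on_x3_def u_def v_def by (blast intro: arg_cong[where f = inverse])+
  have image: "(\<lambda>x. x $ 3) ` I = I3"
  proof (intro equalityI subsetI)
    fix t assume "t \<in> I3"
    from imageI[OF e[OF this], of "\<lambda>x. x $ 3"] show "t \<in> (\<lambda>x. x $ 3) ` I"
      by (simp add: e3)
  qed (auto dest: x3)
  have smooth: "smooth_on I (\<lambda>x. inverse (f1 x))" "smooth_on I (\<lambda>x. inverse (f2 x))"
    using smooth_on_inverse[OF open_I] assms(11-14) by blast+
  interpret x3_profile I I3 f1 f2 u v "deriv u" "deriv v" "deriv (deriv u)" "deriv (deriv v)"
    using open_I image u v assms(13,14) e
      smooth_profile[where H = u, OF open_I smooth(1) u, unfolded image]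
      smooth_profile[where H = v, OF open_I smooth(2) v, unfolded image]
    by unfold_locales (auto simp: u_def v_def)
  \<comment> \<open>Openness and the metric axioms hold in any case, so only the curvature condition
    remains.\<close>
  have "flat_riemannian_manifold I (g_tilde f1 f2) \<longleftrightarrow>
      (\<forall>x\<in>I. \<forall>l k i j. riemann (g_tilde f1 f2) l k i j x = 0)"
    using riemannian_metric_on_g_tilde[OF open_I assms(11,12)] assms(13,14) open_I
    by (simp add: flat_riemannian_manifold_def)
  also have "\<dots> \<longleftrightarrow>
      (\<exists>\<alpha> \<beta> \<gamma> \<delta>. \<alpha> * \<gamma> = 0 \<and> (\<forall>t\<in>I3. u t = \<alpha> * t + \<beta> \<and> v t = \<gamma> * t + \<delta>))"
    using assms(7-9) by (intro riemann_vanishes_iff_affine) (auto simp: is_interval_convex)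
  also have "\<dots> \<longleftrightarrow> (\<exists>\<alpha> \<beta> \<gamma> \<delta>. \<alpha> * \<gamma> = 0 \<and>
      (\<forall>x\<in>I. inverse (f1 x) = \<alpha> * x $ 3 + \<beta> \<and> inverse (f2 x) = \<gamma> * x $ 3 + \<delta>))"
    unfolding image[symmetric] using u v by simp
  also have "\<dots> \<longleftrightarrow> ?R"
  proof
    \<comment> \<open>Stated for generic \<open>fi\<close>, \<open>fj\<close> to serve both orders
      of \<open>f1\<close> and \<open>f2\<close>. Inverting \<gamma> * x3 + \<delta> gives c1 =
      1/\<gamma> and c2 = -\<delta>/\<gamma>, while k = 1/\<beta>.\<close>
    have hyperbola: "\<exists>k c1 c2. k \<noteq> 0 \<and> c1 \<noteq> 0 \<and> c2 \<notin> I3 \<and>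
        (\<forall>x\<in>I. fi x = k \<and> fj x = c1 / (x $ 3 - c2))"
      if fi: "\<And>x. x \<in> I \<Longrightarrow> inverse (fi x) = \<beta>" and fj: "\<And>x. x \<in> I \<Longrightarrow> inverse (fj x) = \<gamma> * x $ 3 + \<delta>"
        and "\<gamma> \<noteq> 0" and nz: "\<forall>x\<in>I. fi x \<noteq> 0" "\<forall>x\<in>I. fj x \<noteq> 0"
      for fi fj :: "real^3 \<Rightarrow> real" and \<beta> \<gamma> \<delta>
    proof (intro exI conjI ballI)
      obtain t where "t \<in> I3" using assms(9) by blast
      with e fi nz(1) show "inverse \<beta> \<noteq> 0"
        by fastforce
      show "1 / \<gamma> \<noteq> 0" using \<open>\<gamma> \<noteq> 0\<close> by simp
      show "- \<delta> / \<gamma> \<notin> I3"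
      proof
        \<comment> \<open>At this value of x3 the affine function vanishes, so
          \<open>inverse (fj x)\<close> would be 0 at a point of \<open>I\<close>, contrary to
          \<open>fj x\<close> being nonzero.\<close>
        assume "- \<delta> / \<gamma> \<in> I3"
        from e[OF this] fj[OF e[OF this]] nz(2) show False
          using \<open>\<gamma> \<noteq> 0\<close> by (simp add: e3)
      qed
      fix x assume "x \<in> I"
      show "fi x = inverse \<beta>"
        using fi[OF \<open>x \<in> I\<close>] by (metis inverse_inverse_eq)
      have "fj x = inverse (\<gamma> * x $ 3 + \<delta>)"
        using fj[OF \<open>x \<in> I\<close>] by (metis inverse_inverse_eq)
      also have "\<gamma> * x $ 3 + \<delta> = \<gamma> * (x $ 3 - - \<delta> / \<gamma>)"
        using \<open>\<gamma> \<noteq> 0\<close> by (simp add: field_simps)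
      finally show "fj x = 1 / \<gamma> / (x $ 3 - - \<delta> / \<gamma>)"
        by (simp add: divide_inverse)
    qed
    assume "\<exists>\<alpha> \<beta> \<gamma> \<delta>. \<alpha> * \<gamma> = 0 \<and>
      (\<forall>x\<in>I. inverse (f1 x) = \<alpha> * x $ 3 + \<beta> \<and> inverse (f2 x) = \<gamma> * x $ 3 + \<delta>)"
    then obtain \<alpha> \<beta> \<gamma> \<delta> where "\<alpha> * \<gamma> = 0"
      and f: "\<And>x. x \<in> I \<Longrightarrow> inverse (f1 x) = \<alpha> * x $ 3 + \<beta>" "\<And>x. x \<in> I \<Longrightarrow> inverse (f2 x) = \<gamma> * x $ 3 + \<delta>"
      by blast
    then consider "\<alpha> = 0" "\<gamma> = 0" | "\<alpha> = 0" "\<gamma> \<noteq> 0" | "\<alpha> \<noteq> 0" "\<gamma> = 0"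
      by auto
    then show ?R
    proof cases
      case 1
      then have "f1 x = inverse \<beta> \<and> f2 x = inverse \<delta>" if "x \<in> I" for x
        using f[OF that] by (metis add_0 inverse_inverse_eq mult_zero_left)
      then show ?thesis by blast
    next
      case 2
      then show ?thesis
        using hyperbola[of f1 \<beta> f2 \<gamma> \<delta>] f assms(13,14) by simp
    next
      case 3
      then show ?thesis
        using hyperbola[of f2 \<delta> f1 \<alpha> \<beta>] f assms(13,14) by simp
    qed
  next
    \<comment> \<open>Holds for all reals: when a denominator is 0, both sides are 0 by the
      convention 1/0 = 0.\<close>
    have affine: "inverse (c1 / (x - c2)) = (1 / c1) * x + (- c2 / c1)" for c1 c2 x :: real
      by (simp add: diff_divide_distrib)
    assume ?R
    then consider k1 k2 where "\<forall>x\<in>I. f1 x = k1 \<and> f2 x = k2"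
      | k c1 c2 where "\<forall>x\<in>I. f1 x = k \<and> f2 x = c1 / (x $ 3 - c2)"
      | k c1 c2 where "\<forall>x\<in>I. f2 x = k \<and> f1 x = c1 / (x $ 3 - c2)"
      by (simp only: bex_simps case_prod_conv) blast
    then show "\<exists>\<alpha> \<beta> \<gamma> \<delta>. \<alpha> * \<gamma> = 0 \<and>
      (\<forall>x\<in>I. inverse (f1 x) = \<alpha> * x $ 3 + \<beta> \<and> inverse (f2 x) = \<gamma> * x $ 3 + \<delta>)"
    proof cases
      case 1
      then show ?thesis
        \<comment> \<open>The value 0 serves for both slopes \<alpha> and \<gamma>.\<close>
        by (intro exI[of _ 0] exI[of _ "inverse k1"] exI[of _ "inverse k2"]) simp
    next
      case 2
      then show ?thesis
        \<comment> \<open>The rule \<open>inverse_divide\<close> would rewrite the reciprocal before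
          \<open>affine\<close> could match it.\<close>
        by (intro exI[of _ 0] exI[of _ "inverse k"] exI[of _ "1 / c1"] exI[of _ "- c2 / c1"])
          (simp add: affine del: inverse_divide)
    next
      case 3
      then show ?thesis
        by (intro exI[of _ "1 / c1"] exI[of _ "- c2 / c1"] exI[of _ 0] exI[of _ "inverse k"])
          (simp add: affine del: inverse_divide)
    qed
  qed
  finally show ?thesis .
qed

end
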